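(* Let $d\in\{2,3\}$, $\mathcal{M}\subset\mathbb{R}^d$, let $\mathcal{D}=\{\mathbf{d}_1,\dots,\mathbf{d}_n\}\subset\mathbb{S}^{d-1}$ be a directional basis, $\varepsilon>0$, and let $w_1,\dots,w_n$ be the associated softmax weights. For any $\mathbf{p}\in\mathcal{M}$ and any environment signal $f=f_{\mathbf{p}}\in L^1(\mathbb{S}^{d-1})$, the feature components $\phi_i(\mathbf{p})=\int_{\mathbb{S}^{d-1}}f(\boldsymbol\theta)w_i(\boldsymbol\theta)\,\mathrm{d}\sigma(\boldsymbol\theta)$ satisfy $$\sum_{i=1}^n\phi_i(\mathbf{p})=\int_{\mathbb{S}^{d-1}}f(\boldsymbol\theta)\,\mathrm{d}\sigma(\boldsymbol\theta).$$
   Context: $\mathbb{S}^{d-1}$ is the unit sphere of $\mathbb{R}^d$ with standard surface measure $\sigma$. A directional basis is a finite set of unit vectors. The softmax weights associated with $\{\mathbf{d}_1,\dots,\mathbf{d}_n\}$ and temperature $\varepsilon>0$ are $$w_i(\boldsymbol\theta)=\frac{\exp(\boldsymbol\theta^{\top}\mathbf{d}_i/\varepsilon)}{\sum_{j=1}^n\exp(\boldsymbol\theta^{\top}\mathbf{d}_j/\varepsilon)}.$$ The environment signal at $\mathbf{p}$ is a scalar function $f_{\mathbf{p}}:\mathbb{S}^{d-1}\to\mathbb{R}$. *)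

theory Defs
  imports "HOL-Analysis.Analysis"
begin

(* Normalised cone measure: a Borel set A of the unit sphere gets DIM('a) times the Lebesgue
   measure of its punctured cone {x. 0 < norm x < 1, x / norm x in A}, as in polar coordinates.
   The underlying space is the sphere itself, so values of functions off the sphere are
   irrelevant. *)
definition sphere_measure :: "'a::euclidean_space measure" where
  "sphere_measure =
     scale_measure (of_nat DIM('a))
       (distr (restrict_space lborel (ball 0 1 - {0})) (restrict_space borel (sphere 0 1)) sgn)"

lemma space_sphere_measure [simp]:
  "space (sphere_measure :: 'a::euclidean_space measure) = sphere 0 1"
  by (simp add: sphere_measure_def space_scale_measure space_restrict_space)

lemma sets_sphere_measure [measurable_cong]:
  "sets (sphere_measure :: 'a::euclidean_space measure) = sets (restrict_space borel (sphere 0 1))"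
  by (simp add: sphere_measure_def)

lemma sgn_measurable_sphere:
  "(sgn :: 'a::euclidean_space \<Rightarrow> 'a)
     \<in> restrict_space lborel (ball 0 1 - {0}) \<rightarrow>\<^sub>M restrict_space borel (sphere 0 1)"
proof (rule measurable_restrict_space2)
  show "(sgn :: 'a \<Rightarrow> 'a) \<in> space (restrict_space lborel (ball 0 1 - {0})) \<rightarrow> sphere 0 1"
    by (auto simp: space_restrict_space norm_sgn)
  have "(sgn :: 'a \<Rightarrow> 'a) \<in> borel_measurable borel"
    unfolding sgn_div_norm by measurable
  then show "(sgn :: 'a \<Rightarrow> 'a) \<in> borel_measurable (restrict_space lborel (ball 0 1 - {0}))"
    by (intro measurable_restrict_space1) simp
qed

lemma emeasure_sphere_measure:
  fixes A :: "'a::euclidean_space set"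
  assumes "A \<in> sets borel" "A \<subseteq> sphere 0 1"
  shows "emeasure sphere_measure A =
    of_nat DIM('a) * emeasure lborel {x. x \<noteq> 0 \<and> norm x < 1 \<and> x /\<^sub>R norm x \<in> A}"
proof -
  have A: "A \<in> sets (restrict_space borel (sphere 0 1))"
    using assms by (auto simp: sets_restrict_space)
  have eq: "sgn -` A \<inter> space (restrict_space lborel (ball 0 1 - {0})) =
      {x. x \<noteq> 0 \<and> norm x < 1 \<and> x /\<^sub>R norm x \<in> A}"
    by (auto simp: space_restrict_space sgn_div_norm)
  show ?thesis
    unfolding sphere_measure_def emeasure_scale_measure
      emeasure_distr[OF sgn_measurable_sphere A] eq
    by (subst emeasure_restrict_space) (auto simp: subset_iff)
qed

lemma emeasure_sphere_measure_sphere: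
  "emeasure sphere_measure (sphere 0 1 :: 'a::euclidean_space set) =
     ennreal (real DIM('a) * unit_ball_vol (real DIM('a)))"
proof -
  have "{x::'a. x \<noteq> 0 \<and> norm x < 1 \<and> x /\<^sub>R norm x \<in> sphere 0 1} = ball 0 1 - {0}"
    by auto
  then have "emeasure sphere_measure (sphere 0 1 :: 'a set) =
      of_nat DIM('a) * emeasure lborel (ball (0::'a) 1 - {0})"
    by (simp add: emeasure_sphere_measure)
  also have "emeasure lborel (ball (0::'a) 1 - {0}) = emeasure lborel (ball (0::'a) 1)"
    by (rule emeasure_Diff_null_set) (auto simp: null_sets_def)
  also have "\<dots> = ennreal (unit_ball_vol (real DIM('a)))"
    by (subst emeasure_ball) auto
  finally show ?thesis
    by (simp add: ennreal_mult' ennreal_of_nat_eq_real_of_nat)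
qed

corollary emeasure_circle:
  "emeasure sphere_measure (sphere 0 1 :: (real ^ 2) set) = ennreal (2 * pi)"
  by (simp add: emeasure_sphere_measure_sphere unit_ball_vol_2)

corollary emeasure_sphere_3:
  "emeasure sphere_measure (sphere 0 1 :: (real ^ 3) set) = ennreal (4 * pi)"
  by (simp add: emeasure_sphere_measure_sphere unit_ball_vol_3)

definition directional_basis :: "'a::euclidean_space set \<Rightarrow> bool" where
  "directional_basis D \<longleftrightarrow> finite D \<and> D \<subseteq> sphere 0 1"

definition softmax_weight ::
    "real \<Rightarrow> nat \<Rightarrow> (nat \<Rightarrow> 'a::euclidean_space) \<Rightarrow> nat \<Rightarrow> 'a \<Rightarrow> real" where
  "softmax_weight \<epsilon> n dir i \<theta> =
     exp ((\<theta> \<bullet> dir i) / \<epsilon>) / (\<Sum>j=1..n. exp ((\<theta> \<bullet> dir j) / \<epsilon>))"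

(* The signal f takes the base point first: f p is the signal on the sphere seen from p. *)
definition feature_component ::
    "real \<Rightarrow> nat \<Rightarrow> (nat \<Rightarrow> 'a::euclidean_space) \<Rightarrow> ('a \<Rightarrow> 'a \<Rightarrow> real) \<Rightarrow> nat \<Rightarrow> 'a \<Rightarrow> real" where
  "feature_component \<epsilon> n dir f i p =
     (LINT \<theta>|sphere_measure. f p \<theta> * softmax_weight \<epsilon> n dir i \<theta>)"

end

theory Submission imports Defs begin

text \<open>The softmax weights are a partition of unity: at every direction they are nonnegative
  and add up to 1 (\<open>sum_softmax_weight\<close>). So the signal is pointwise the sum of its
  products with the weights, and the claim is linearity of the integral. Linearity needs each
  product to be integrable, which \<open>integrable_mult_softmax_weight\<close> obtains by
  domination from the integrability of the signal.\<close>

lemma borel_measurable_softmax_weight: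
  "softmax_weight \<epsilon> n dir i \<in> borel_measurable sphere_measure"
proof -
  have "softmax_weight \<epsilon> n dir i \<in> borel_measurable borel"
    unfolding softmax_weight_def by measurable
  \<comment> \<open>The sigma-algebra of \<open>sphere_measure\<close> is \<open>borel\<close>
    restricted to the sphere, so measurability on the whole space is inherited.\<close>
  then show ?thesis
    by (simp add: measurable_restrict_space1
        cong: measurable_cong_sets[OF sets_sphere_measure refl])
qed

lemma softmax_weight_nonneg: "softmax_weight \<epsilon> n dir i \<theta> \<ge> 0"
  by (simp add: softmax_weight_def sum_nonneg)

text \<open>The numerators add up to the common denominator, which cancels because it is a nonempty
  sum of exponentials and hence positive. For \<open>n = 0\<close> the empty sum would be 0.\<close>

lemma sum_softmax_weight:
  assumes "n \<ge> 1"
  shows "(\<Sum>i=1..n. softmax_weight \<epsilon> n dir i \<theta>) = 1"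
proof -
  have "(\<Sum>j=1..n. exp ((\<theta> \<bullet> dir j) / \<epsilon>)) > 0"
    using assms by (intro sum_pos) auto
  then show ?thesis
    by (simp add: softmax_weight_def flip: sum_divide_distrib)
qed

text \<open>Each weight is one term of a sum of nonnegative terms with total 1.\<close>

lemma softmax_weight_le_1:
  assumes "i \<in> {1..n}"
  shows "softmax_weight \<epsilon> n dir i \<theta> \<le> 1"
proof -
  have "softmax_weight \<epsilon> n dir i \<theta> \<le> (\<Sum>j=1..n. softmax_weight \<epsilon> n dir j \<theta>)"
    using assms by (intro member_le_sum) (auto simp: softmax_weight_nonneg)
  also have "\<dots> = 1"
    using assms by (intro sum_softmax_weight) auto
  finally show ?thesis .
qed

text \<open>The weights are measurable with values between 0 and 1, so \<open>g\<close> itself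
  dominates the product.\<close>

lemma integrable_mult_softmax_weight:
  assumes "integrable sphere_measure g" "i \<in> {1..n}"
  shows "integrable sphere_measure (\<lambda>\<theta>. g \<theta> * softmax_weight \<epsilon> n dir i \<theta>)"
proof (rule Bochner_Integration.integrable_bound[OF assms(1)])
  show "(\<lambda>\<theta>. g \<theta> * softmax_weight \<epsilon> n dir i \<theta>) \<in> borel_measurable sphere_measure"
    using assms(1) by (intro borel_measurable_times borel_measurable_softmax_weight) auto
  show "AE \<theta> in sphere_measure. norm (g \<theta> * softmax_weight \<epsilon> n dir i \<theta>) \<le> norm (g \<theta>)"
    using assms(2)
    by (intro AE_I2) (simp add: abs_mult softmax_weight_nonneg softmax_weight_le_1 mult_left_le)
qed

theorem proposition1:
  fixes M D :: "(real ^ 'd) set"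
    and dir :: "nat \<Rightarrow> real ^ 'd"
    and n :: nat
    and \<epsilon> :: real
    and p :: "real ^ 'd"
    and f :: "real ^ 'd \<Rightarrow> real ^ 'd \<Rightarrow> real"
  assumes "CARD('d) \<in> {2, 3}"
    and "n \<ge> 1"
    and "D = dir ` {1..n}"
    and "directional_basis D"
    and "\<epsilon> > 0"
    and "p \<in> M"
    and "integrable sphere_measure (f p)"
  shows "(\<Sum>i=1..n. feature_component \<epsilon> n dir f i p) = (LINT \<theta>|sphere_measure. f p \<theta>)"
proof -
  have "(\<Sum>i=1..n. feature_component \<epsilon> n dir f i p) =
      (LINT \<theta>|sphere_measure. (\<Sum>i=1..n. f p \<theta> * softmax_weight \<epsilon> n dir i \<theta>))"
    unfolding feature_component_def
    using assms(7) by (intro Bochner_Integration.integral_sum[symmetric] integrable_mult_softmax_weight)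
  \<comment> \<open>Under the integral, \<open>f p \<theta>\<close> factors out of the sum, leaving
    the weights, which sum to 1.\<close>
  also have "\<dots> = (LINT \<theta>|sphere_measure. f p \<theta>)"
    by (simp only: sum_softmax_weight[OF assms(2)] mult_1_right flip: sum_distrib_left)
  finally show ?thesis .
qed

end
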